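(* Let $d,n,K$ be positive integers, $\epsilon\in(0,1)$, let $X\subset\mathbf{R}^{n}$ be a nonempty convex compact set, $A\in\mathbf{R}^{d\times n}$, $a\in\mathbf{R}^d$, let $x\mapsto M(x)$ be an affine mapping from $\mathbf{R}^n$ to the space $\mathbf{S}^d$ of symmetric $d\times d$ matrices such that $M(x)\succeq0$ for all $x\in X$, and let $G(x)=g^Tx+c$ be an affine function on $\mathbf{R}^n$. For $f\in\mathbf{R}^d$ set $$\widehat{\Psi}_+(f)=\max_{x\in X}\left\{\left[2K^{-1}\ln(2/\epsilon)f^TM(x)f\right]^{1/2}+f^TAx-G(x)\right\}+a^Tf,$$ $$\widehat{\Psi}_-(f)=\max_{y\in X}\left\{\left[2K^{-1}\ln(2/\epsilon)f^TM(y)f\right]^{1/2}-f^TAy+G(y)\right\}-a^Tf,$$ and consider the convex optimization problem $$\mathrm{Opt}=\min_{f\in\mathbf{R}^d}\left\{\widehat\Psi(f):=\tfrac12\left[\widehat\Psi_+(f)+\widehat\Psi_-(f)\right]\right\}.$$ Let $\bar f\in\mathbf{R}^d$ be a feasible solution to this problem, and set $$\bar\varkappa=\tfrac12\left[\widehat\Psi_-(\bar f)-\widehat\Psi_+(\bar f)\right],\qquad\bar\rho=\widehat\Psi(\bar f).$$ Then the $\epsilon$-risk of the affine estimate $$\widehat g(\omega^K)=\frac1K\sum_{i=1}^K\bar f^T\omega_i+\bar\varkappa$$ of $G(x)$, $x\in X$, via $K$ i.i.d. observations $\omega^K=(\omega_1,\dots,\omega_K)$ is at most $\bar\rho$; that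 is, for every $x\in X$ and every distribution $P\in\mathcal{SG}(Ax+a,M(x))$, $$\mathrm{Prob}_{\omega^K\sim P^K}\left\{|\widehat g(\omega^K)-G(x)|>\bar\rho\right\}\le\epsilon.$$
   Context: For $\theta\in\mathbf{R}^d$ and a positive semidefinite $\Theta\in\mathbf{S}^d$, $\mathcal{SG}(\theta,\Theta)$ is the family of all sub-Gaussian distributions with parameters $(\theta,\Theta)$, i.e., all Borel probability distributions $P$ on $\mathbf{R}^d$ such that $\ln\left(\mathbf{E}_{\zeta\sim P}\{\exp\{f^T\zeta\}\}\right)\le f^T\theta+\frac12f^T\Theta f$ for all $f\in\mathbf{R}^d$. $P^K$ denotes the distribution of an i.i.d. sample $(\omega_1,\dots,\omega_K)$ with $\omega_i\sim P$. The $\epsilon$-risk of an estimate $\widehat g$ (a Borel function of $\omega^K$) is the smallest $\rho$ such that $\mathrm{Prob}_{\omega^K\sim P^K}\{|\widehat g(\omega^K)-G(x)|>\rho\}\le\epsilon$ for all $x\in X$ and all $P\in\mathcal{SG}(Ax+a,M(x))$. *)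

theory Defs
  imports "HOL-Probability.Probability"
begin

definition pos_semidef :: "real^'d^'d \<Rightarrow> bool" where
  "pos_semidef S \<longleftrightarrow> transpose S = S \<and> (\<forall>v. 0 \<le> v \<bullet> (S *v v))"

text \<open>Integrability is required explicitly: it says that the expectation is finite, whereas the
  Bochner integral of a non-integrable function is 0 (and so is \<open>ln 0\<close>).\<close>

definition sub_gaussian :: "real^'d \<Rightarrow> real^'d^'d \<Rightarrow> (real^'d) measure set" where
  "sub_gaussian \<theta> \<Theta> =
    {P. prob_space P \<and> sets P = sets borel \<and>
        (\<forall>f. integrable P (\<lambda>z. exp (f \<bullet> z)) \<and>
             ln (\<integral>z. exp (f \<bullet> z) \<partial>P) \<le> f \<bullet> \<theta> + 1/2 * (f \<bullet> (\<Theta> *v f)))}"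

definition iid_sample :: "nat \<Rightarrow> 'a measure \<Rightarrow> (nat \<Rightarrow> 'a) measure" where
  "iid_sample K P = (\<Pi>\<^sub>M i\<in>{1..K}. P)"

definition risk_bound ::
  "nat \<Rightarrow> real \<Rightarrow> (real^'n) set \<Rightarrow> real^'n^'d \<Rightarrow> real^'d \<Rightarrow> (real^'n \<Rightarrow> real^'d^'d)
    \<Rightarrow> (real^'n \<Rightarrow> real) \<Rightarrow> ((nat \<Rightarrow> real^'d) \<Rightarrow> real) \<Rightarrow> real \<Rightarrow> bool" where
  "risk_bound K \<epsilon> X A a M G g \<rho> \<longleftrightarrow>
    (\<forall>x\<in>X. \<forall>P\<in>sub_gaussian (A *v x + a) (M x).
       measure (iid_sample K P) {\<omega> \<in> space (iid_sample K P). \<bar>g \<omega> - G x\<bar> > \<rho>} \<le> \<epsilon>)"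

text \<open>Meant for Borel estimates \<open>g\<close>. The risk is \<open>\<infinity>\<close> if no real \<open>\<rho>\<close> qualifies; otherwise, for
  nonempty \<open>X\<close>, Borel \<open>g\<close>, \<open>\<epsilon> < 1\<close> and positive semidefinite \<open>M x\<close> on \<open>X\<close>, the infimum is attained
  by continuity of measure from below, hence is the smallest such \<open>\<rho>\<close>.\<close>

definition eps_risk ::
  "nat \<Rightarrow> real \<Rightarrow> (real^'n) set \<Rightarrow> real^'n^'d \<Rightarrow> real^'d \<Rightarrow> (real^'n \<Rightarrow> real^'d^'d)
    \<Rightarrow> (real^'n \<Rightarrow> real) \<Rightarrow> ((nat \<Rightarrow> real^'d) \<Rightarrow> real) \<Rightarrow> ereal" where
  "eps_risk K \<epsilon> X A a M G g = Inf (ereal ` {\<rho>. risk_bound K \<epsilon> X A a M G g \<rho>})"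

text \<open>The suprema below are maxima whenever \<open>X\<close> is nonempty and compact and \<open>M\<close> and \<open>G\<close> are affine,
  since the objectives are then continuous in \<open>x\<close>.\<close>

definition Psi_plus ::
  "nat \<Rightarrow> real \<Rightarrow> (real^'n) set \<Rightarrow> real^'n^'d \<Rightarrow> real^'d \<Rightarrow> (real^'n \<Rightarrow> real^'d^'d)
    \<Rightarrow> (real^'n \<Rightarrow> real) \<Rightarrow> real^'d \<Rightarrow> real" where
  "Psi_plus K \<epsilon> X A a M G f =
    (SUP x\<in>X. sqrt (2 / real K * ln (2 / \<epsilon>) * (f \<bullet> (M x *v f))) + f \<bullet> (A *v x) - G x) + a \<bullet> f"

definition Psi_minus ::
  "nat \<Rightarrow> real \<Rightarrow> (real^'n) set \<Rightarrow> real^'n^'d \<Rightarrow> real^'d \<Rightarrow> (real^'n \<Rightarrow> real^'d^'d)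
    \<Rightarrow> (real^'n \<Rightarrow> real) \<Rightarrow> real^'d \<Rightarrow> real" where
  "Psi_minus K \<epsilon> X A a M G f =
    (SUP y\<in>X. sqrt (2 / real K * ln (2 / \<epsilon>) * (f \<bullet> (M y *v f))) - f \<bullet> (A *v y) + G y) - a \<bullet> f"

definition Psi ::
  "nat \<Rightarrow> real \<Rightarrow> (real^'n) set \<Rightarrow> real^'n^'d \<Rightarrow> real^'d \<Rightarrow> (real^'n \<Rightarrow> real^'d^'d)
    \<Rightarrow> (real^'n \<Rightarrow> real) \<Rightarrow> real^'d \<Rightarrow> real" where
  "Psi K \<epsilon> X A a M G f = 1/2 * (Psi_plus K \<epsilon> X A a M G f + Psi_minus K \<epsilon> X A a M G f)"

definition affine_estimate :: "nat \<Rightarrow> real^'d \<Rightarrow> real \<Rightarrow> (nat \<Rightarrow> real^'d) \<Rightarrow> real" where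
  "affine_estimate K f \<kappa> \<omega> = 1 / real K * (\<Sum>i=1..K. f \<bullet> \<omega> i) + \<kappa>"

end

theory Submission
  imports Defs
begin

text \<open>
  The estimate is an affine function of the sample mean of \<open>f \<bullet> \<omega>\<^sub>i\<close>, so its error is governed by
  \<open>Y = mean - f \<bullet> (A *v x + a)\<close>.  By independence the moment generating functions multiply, which
  shows that \<open>Y\<close> is sub-Gaussian with variance proxy \<open>v = f \<bullet> (M x *v f) / K\<close>
  (\<open>mgf_centred_sample_mean\<close>), and the same bound, being even in the exponent, holds for \<open>- Y\<close>.
  The Chernoff bound then gives either tail beyond \<open>sqrt (2 * ln (2 / \<epsilon>) * v)\<close> probability at most
  \<open>\<epsilon> / 2\<close> (\<open>sub_gaussian_tail\<close>).

  The functionals \<open>Psi_plus\<close> and \<open>Psi_minus\<close> are built so that these thresholds are exactly what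
  is required: \<open>\<rho> - \<kappa> = Psi_plus\<close> and \<open>\<rho> + \<kappa> = Psi_minus\<close>, and bounding each supremum below by its
  value at the true \<open>x\<close> shows that an error above \<open>\<rho>\<close> forces \<open>Y\<close>, and an error below \<open>- \<rho>\<close> forces
  \<open>- Y\<close>, to exceed the threshold.  A union bound over the two tails concludes.  Compactness of the
  signal set enters only to make the suprema finite.
\<close>

text \<open>The exponent optimal in the Chernoff bound is the threshold divided by \<open>v\<close>.  This choice breaks
  down for \<open>v = 0\<close>; then \<open>exp Y + exp (- Y) - 2\<close> is a nonnegative function with nonpositive
  expectation, so that \<open>Y\<close> vanishes almost surely and the strict tail is null.\<close>

lemma (in prob_space) sub_gaussian_tail:
  fixes Y :: "'a \<Rightarrow> real"
  assumes [measurable]: "random_variable borel Y"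
    and int: "\<And>t. integrable M (\<lambda>\<omega>. exp (t * Y \<omega>))"
    and mgf: "\<And>t. expectation (\<lambda>\<omega>. exp (t * Y \<omega>)) \<le> exp (t\<^sup>2 * v / 2)"
    and v: "0 \<le> v" and L: "0 < L"
  shows "prob {\<omega> \<in> space M. sqrt (2 * L * v) < Y \<omega>} \<le> exp (- L)"
proof (cases "v = 0")
  case True
  let ?h = "\<lambda>\<omega>. exp (1 * Y \<omega>) + exp (-1 * Y \<omega>) - 2"
  have h_eq: "?h \<omega> = (exp (Y \<omega> / 2) - exp (- Y \<omega> / 2))\<^sup>2" for \<omega>
    by (simp add: power2_diff flip: exp_double exp_add)
  have h_int: "integrable M ?h"
    using int[of 1] int[of "-1"] by simp
  have "expectation ?h = expectation (\<lambda>\<omega>. exp (1 * Y \<omega>)) + expectation (\<lambda>\<omega>. exp (-1 * Y \<omega>)) - 2"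
    using int[of 1] int[of "-1"] by (simp add: prob_space)
  also have "\<dots> \<le> 0"
    using mgf[of 1] mgf[of "-1"] True by simp
  finally have "expectation ?h = 0"
    by (intro antisym integral_nonneg_AE) (auto simp only: h_eq zero_le_power2 intro: AE_I2)
  then have "AE \<omega> in M. ?h \<omega> = 0"
    by (subst (asm) integral_nonneg_eq_0_iff_AE[OF h_int]) (auto simp only: h_eq zero_le_power2 intro: AE_I2)
  then have "AE \<omega> in M. \<not> sqrt (2 * L * v) < Y \<omega>"
    by eventually_elim (use True in \<open>simp only: h_eq\<close>, simp)
  then have "prob {\<omega> \<in> space M. sqrt (2 * L * v) < Y \<omega>} = 0"
    by (subst prob_eq_0) auto
  then show ?thesis by simp
next
  case False
  with v have v_pos: "0 < v" by simp
  define s where "s = sqrt (2 * L * v)"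
  have s: "0 < s" "s\<^sup>2 = 2 * L * v"
    using v_pos L by (auto simp: s_def)
  define t where "t = s / v"
  have t: "0 < t" using s v_pos by (simp add: t_def)
  have "prob {\<omega> \<in> space M. s < Y \<omega>} \<le> prob {\<omega> \<in> space M. exp (t * s) \<le> exp (t * Y \<omega>)}"
    using t by (intro finite_measure_mono) auto
  also have "\<dots> \<le> expectation (\<lambda>\<omega>. exp (t * Y \<omega>)) / exp (t * s)"
    by (rule integral_Markov_inequality_measure[OF int sets.empty_sets]) auto
  also have "\<dots> \<le> exp (t\<^sup>2 * v / 2) / exp (t * s)"
    by (intro divide_right_mono mgf) simp
  also have "\<dots> = exp (t\<^sup>2 * v / 2 - t * s)" by (simp add: exp_diff)
  also have "t\<^sup>2 * v / 2 - t * s = - (s\<^sup>2 / (2 * v))"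
    using v_pos by (simp add: t_def power2_eq_square field_simps)
  also have "\<dots> = - L" using v_pos s by simp
  finally show ?thesis by (simp add: s_def)
qed

lemma prob_space_iid_sample: "prob_space P \<Longrightarrow> prob_space (iid_sample K P)"
  unfolding iid_sample_def by (rule prob_space_PiM)

text \<open>Scaling the test vector by \<open>t / K\<close> turns the exponential of the mean into a product of
  exponentials of independent terms.  Each of the \<open>K\<close> factors contributes \<open>(t / K)\<^sup>2\<close> times the quadratic
  form, which is where the variance proxy gains its factor \<open>1 / K\<close>.  For an empty sample the mean
  is the default value 0, which is not centred at \<open>f \<bullet> \<theta>\<close>; hence \<open>K \<ge> 1\<close>.\<close>

lemma mgf_centred_sample_mean:
  fixes P :: "(real^'d) measure" and f :: "real^'d"
  assumes K: "K \<ge> 1" and P: "P \<in> sub_gaussian \<theta> \<Theta>"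
  defines "Y \<equiv> \<lambda>\<omega>. 1 / real K * (\<Sum>i=1..K. f \<bullet> \<omega> i) - f \<bullet> \<theta>"
  shows "Y \<in> borel_measurable (iid_sample K P)"
    and "integrable (iid_sample K P) (\<lambda>\<omega>. exp (t * Y \<omega>))"
    and "(\<integral>\<omega>. exp (t * Y \<omega>) \<partial>iid_sample K P) \<le> exp (t\<^sup>2 * (f \<bullet> (\<Theta> *v f) / real K) / 2)"
proof -
  interpret P: prob_space P using P by (simp add: sub_gaussian_def)
  interpret product_sigma_finite "\<lambda>_. P" by standard
  have [measurable_cong]: "sets P = sets borel" using P by (simp add: sub_gaussian_def)
  show "Y \<in> borel_measurable (iid_sample K P)"
    unfolding Y_def iid_sample_def by measurable
  define F where "F = (t / real K) *\<^sub>R f"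
  let ?E = "\<integral>z. exp (F \<bullet> z) \<partial>P"
  have F_int: "integrable P (\<lambda>z. exp (F \<bullet> z))"
    and F_ln: "ln ?E \<le> F \<bullet> \<theta> + 1/2 * (F \<bullet> (\<Theta> *v F))"
    using P by (auto simp: sub_gaussian_def)
  have E_nonneg: "0 \<le> ?E" by (rule Bochner_Integration.integral_nonneg) simp
  have "?E \<le> exp (ln ?E)"
    using E_nonneg by (cases "?E = 0") (simp_all add: order_less_le)
  also have "\<dots> \<le> exp (F \<bullet> \<theta> + 1/2 * (F \<bullet> (\<Theta> *v F)))"
    using F_ln by simp
  finally have E_le: "?E \<le> exp (F \<bullet> \<theta> + 1/2 * (F \<bullet> (\<Theta> *v F)))" .
  have exp_Y: "exp (t * Y \<omega>) = exp (- t * (f \<bullet> \<theta>)) * (\<Prod>i=1..K. exp (F \<bullet> \<omega> i))" for \<omega>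
    by (simp add: Y_def F_def algebra_simps sum_distrib_left sum_divide_distrib flip: exp_sum exp_add)
  show "integrable (iid_sample K P) (\<lambda>\<omega>. exp (t * Y \<omega>))"
    unfolding exp_Y iid_sample_def
    by (intro integrable_mult_right product_integrable_prod F_int) auto
  have "(\<integral>\<omega>. exp (t * Y \<omega>) \<partial>iid_sample K P) = exp (- t * (f \<bullet> \<theta>)) * ?E ^ K"
    unfolding exp_Y iid_sample_def
    by (subst integral_mult_right_zero, subst product_integral_prod) (auto simp: F_int)
  also have "\<dots> \<le> exp (- t * (f \<bullet> \<theta>)) * exp (F \<bullet> \<theta> + 1/2 * (F \<bullet> (\<Theta> *v F))) ^ K"
    by (intro mult_left_mono power_mono E_le E_nonneg) simp
  also have "\<dots> = exp (t\<^sup>2 * (f \<bullet> (\<Theta> *v f) / real K) / 2)"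
    using K by (simp add: F_def matrix_vector_mult_scaleR power2_eq_square field_simps
      flip: exp_of_nat_mult exp_add)
  finally show "(\<integral>\<omega>. exp (t * Y \<omega>) \<partial>iid_sample K P) \<le> exp (t\<^sup>2 * (f \<bullet> (\<Theta> *v f) / real K) / 2)" .
qed

text \<open>The failure probability is split evenly between the two tails, which is the origin of the 2 in
  \<open>ln (2 / \<epsilon>)\<close>.\<close>

lemma sample_mean_deviation:
  fixes P :: "(real^'d) measure" and f :: "real^'d"
  assumes K: "K \<ge> 1" and P: "P \<in> sub_gaussian \<theta> \<Theta>"
    and \<Theta>: "pos_semidef \<Theta>" and \<epsilon>: "0 < \<epsilon>" "\<epsilon> < 2"
  defines "r \<equiv> sqrt (2 / real K * ln (2 / \<epsilon>) * (f \<bullet> (\<Theta> *v f)))"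
  shows "measure (iid_sample K P) {\<omega> \<in> space (iid_sample K P).
    r < \<bar>1 / real K * (\<Sum>i=1..K. f \<bullet> \<omega> i) - f \<bullet> \<theta>\<bar>} \<le> \<epsilon>"
proof -
  interpret S: prob_space "iid_sample K P"
    using P by (intro prob_space_iid_sample) (simp add: sub_gaussian_def)
  define Y where "Y \<omega> = 1 / real K * (\<Sum>i=1..K. f \<bullet> \<omega> i) - f \<bullet> \<theta>" for \<omega> :: "nat \<Rightarrow> real^'d"
  define v where "v = f \<bullet> (\<Theta> *v f) / real K"
  note mgf = mgf_centred_sample_mean[OF K P, where f = f, folded Y_def v_def]
  have [measurable]: "Y \<in> borel_measurable (iid_sample K P)" by (rule mgf(1))
  have v: "0 \<le> v" using \<Theta> by (simp add: v_def pos_semidef_def)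
  have L: "0 < ln (2 / \<epsilon>)" using \<epsilon> by simp
  have r: "r = sqrt (2 * ln (2 / \<epsilon>) * v)" by (simp add: r_def v_def)
  have exp_L: "exp (- ln (2 / \<epsilon>)) = \<epsilon> / 2" using \<epsilon> by (simp add: exp_minus)
  have upper: "S.prob {\<omega> \<in> space (iid_sample K P). r < Y \<omega>} \<le> \<epsilon> / 2"
    unfolding r exp_L[symmetric] by (rule S.sub_gaussian_tail[OF mgf v L])
  have lower: "S.prob {\<omega> \<in> space (iid_sample K P). r < - Y \<omega>} \<le> \<epsilon> / 2"
    unfolding r exp_L[symmetric]
    using mgf(2,3)[of "- t" for t]
    by (intro S.sub_gaussian_tail[OF _ _ _ v L]) auto
  have "{\<omega> \<in> space (iid_sample K P). r < \<bar>Y \<omega>\<bar>} =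
    {\<omega> \<in> space (iid_sample K P). r < Y \<omega>} \<union> {\<omega> \<in> space (iid_sample K P). r < - Y \<omega>}"
    by auto
  then have "S.prob {\<omega> \<in> space (iid_sample K P). r < \<bar>Y \<omega>\<bar>} \<le>
    S.prob {\<omega> \<in> space (iid_sample K P). r < Y \<omega>} + S.prob {\<omega> \<in> space (iid_sample K P). r < - Y \<omega>}"
    by (simp add: measure_Un_le)
  with upper lower show ?thesis by (simp add: Y_def)
qed

lemma continuous_on_quadratic_form_affine:
  fixes M :: "real^'n \<Rightarrow> real^'d^'d"
  assumes "linear L" and "\<And>x. M x = L x + M0"
  shows "continuous_on X (\<lambda>x. f \<bullet> (M x *v f))"
proof -
  have "linear (\<lambda>x. f \<bullet> (L x *v f))"
    by (rule linearI)
      (simp_all add: linear_add[OF assms(1)] linear_scale[OF assms(1)]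
        matrix_vector_mult_add_rdistrib inner_add_right scaleR_matrix_vector_assoc[symmetric])
  then have "continuous_on X (\<lambda>x. f \<bullet> (L x *v f) + f \<bullet> (M0 *v f))"
    by (intro continuous_on_add linear_continuous_on continuous_on_const)
      (simp add: linear_conv_bounded_linear)
  then show ?thesis
    by (simp add: assms(2) matrix_vector_mult_add_rdistrib inner_add_right)
qed

context
  fixes K :: nat and \<epsilon> :: real
    and X :: "(real^'n) set" and A :: "real^'n^'d"
    and M :: "real^'n \<Rightarrow> real^'d^'d" and G :: "real^'n \<Rightarrow> real" and f :: "real^'d"
  assumes X: "compact X" and G: "continuous_on X G"
    and quad: "continuous_on X (\<lambda>x. f \<bullet> (M x *v f))"
begin

text \<open>A supremum of reals bounds its members only if it is taken over a set bounded above; that is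
  what continuity on a compact set provides.  The offset \<open>a \<bullet> f\<close>, kept outside the supremum in the
  definition, is absorbed here so that the expectation \<open>A *v x + a\<close> of the observations appears.\<close>

lemma Psi_plus_ge:
  assumes "x \<in> X"
  shows "sqrt (2 / real K * ln (2 / \<epsilon>) * (f \<bullet> (M x *v f))) + f \<bullet> (A *v x + a) - G x
    \<le> Psi_plus K \<epsilon> X A a M G f"
proof -
  have "continuous_on X (\<lambda>x. sqrt (2 / real K * ln (2 / \<epsilon>) * (f \<bullet> (M x *v f))) + f \<bullet> (A *v x) - G x)"
    by (intro continuous_intros quad G matrix_vector_mult_linear_continuous_on)
  from cSUP_upper[OF assms bounded_imp_bdd_above[OF compact_imp_bounded[OF
        compact_continuous_image[OF this X]]]]
  show ?thesis
    by (simp add: Psi_plus_def inner_add_right inner_commute)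
qed

lemma Psi_minus_ge:
  assumes "x \<in> X"
  shows "sqrt (2 / real K * ln (2 / \<epsilon>) * (f \<bullet> (M x *v f))) - f \<bullet> (A *v x + a) + G x
    \<le> Psi_minus K \<epsilon> X A a M G f"
proof -
  have "continuous_on X (\<lambda>x. sqrt (2 / real K * ln (2 / \<epsilon>) * (f \<bullet> (M x *v f))) - f \<bullet> (A *v x) + G x)"
    by (intro continuous_intros quad G matrix_vector_mult_linear_continuous_on)
  from cSUP_upper[OF assms bounded_imp_bdd_above[OF compact_imp_bounded[OF
        compact_continuous_image[OF this X]]]]
  show ?thesis
    by (simp add: Psi_minus_def inner_add_right inner_commute)
qed

end

theorem proposition4p1:
  fixes K :: nat and \<epsilon> c \<kappa> \<rho> :: real
    and X :: "(real^'n) set" and A :: "real^'n^'d" and a :: "real^'d"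
    and M :: "real^'n \<Rightarrow> real^'d^'d"
    and G :: "real^'n \<Rightarrow> real" and g :: "real^'n"
    and f :: "real^'d"
  assumes "K \<ge> 1" and "0 < \<epsilon>" and "\<epsilon> < 1"
    and "X \<noteq> {}" and "convex X" and "compact X"
    and "\<exists>L M0. linear L \<and> (\<forall>x. M x = L x + M0)"
    and "\<forall>x. transpose (M x) = M x"
    and "\<forall>x\<in>X. pos_semidef (M x)"
    and "\<forall>x. G x = g \<bullet> x + c"
    and "\<kappa> = 1/2 * (Psi_minus K \<epsilon> X A a M G f - Psi_plus K \<epsilon> X A a M G f)"
    and "\<rho> = Psi K \<epsilon> X A a M G f"
  shows "eps_risk K \<epsilon> X A a M G (affine_estimate K f \<kappa>) \<le> ereal \<rho> \<and>
    (\<forall>x\<in>X. \<forall>P\<in>sub_gaussian (A *v x + a) (M x).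
       measure (iid_sample K P)
         {\<omega> \<in> space (iid_sample K P). \<bar>affine_estimate K f \<kappa> \<omega> - G x\<bar> > \<rho>} \<le> \<epsilon>)"
proof -
  have quad: "continuous_on X (\<lambda>x. f \<bullet> (M x *v f))"
    using assms(7) continuous_on_quadratic_form_affine by metis
  have G: "continuous_on X G"
  proof -
    have "G = (\<lambda>x. g \<bullet> x + c)" using assms(10) by auto
    then show ?thesis by (auto intro!: continuous_intros)
  qed
  have risk: "measure (iid_sample K P)
      {\<omega> \<in> space (iid_sample K P). \<bar>affine_estimate K f \<kappa> \<omega> - G x\<bar> > \<rho>} \<le> \<epsilon>"
    if x: "x \<in> X" and P: "P \<in> sub_gaussian (A *v x + a) (M x)" for x P
  proof -
    interpret S: prob_space "iid_sample K P"
      using P by (intro prob_space_iid_sample) (simp add: sub_gaussian_def)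
    define Y where "Y \<omega> = 1 / real K * (\<Sum>i=1..K. f \<bullet> \<omega> i) - f \<bullet> (A *v x + a)"
      for \<omega> :: "nat \<Rightarrow> real^'d"
    define r where "r = sqrt (2 / real K * ln (2 / \<epsilon>) * (f \<bullet> (M x *v f)))"
    have [measurable]: "Y \<in> borel_measurable (iid_sample K P)"
      unfolding Y_def by (rule mgf_centred_sample_mean(1)[OF assms(1) P])
    have "r < \<bar>Y \<omega>\<bar>" if err: "\<bar>affine_estimate K f \<kappa> \<omega> - G x\<bar> > \<rho>" for \<omega>
    proof -
      have "r + f \<bullet> (A *v x + a) - G x \<le> \<rho> - \<kappa>"
        using Psi_plus_ge[OF assms(6) G quad x, of K \<epsilon> A a]
        by (simp add: r_def assms(11,12) Psi_def field_simps)
      moreover have "r - f \<bullet> (A *v x + a) + G x \<le> \<rho> + \<kappa>"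
        using Psi_minus_ge[OF assms(6) G quad x, of K \<epsilon> A a]
        by (simp add: r_def assms(11,12) Psi_def field_simps)
      moreover have "affine_estimate K f \<kappa> \<omega> = Y \<omega> + f \<bullet> (A *v x + a) + \<kappa>"
        by (simp add: affine_estimate_def Y_def)
      ultimately show ?thesis using err by linarith
    qed
    then have "S.prob {\<omega> \<in> space (iid_sample K P). \<bar>affine_estimate K f \<kappa> \<omega> - G x\<bar> > \<rho>}
      \<le> S.prob {\<omega> \<in> space (iid_sample K P). r < \<bar>Y \<omega>\<bar>}"
      by (intro S.finite_measure_mono) auto
    also have "\<dots> \<le> \<epsilon>"
      unfolding Y_def r_def using assms x P by (intro sample_mean_deviation) auto
    finally show ?thesis .
  qed
  then have "risk_bound K \<epsilon> X A a M G (affine_estimate K f \<kappa>) \<rho>"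
    by (simp add: risk_bound_def)
  then have "eps_risk K \<epsilon> X A a M G (affine_estimate K f \<kappa>) \<le> ereal \<rho>"
    unfolding eps_risk_def by (intro Inf_lower) auto
  with risk show ?thesis by blast
qed

end
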